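(* Let $\mu(x)=x^\gamma\ell(x)$ satisfy Assumption A (see context, with parameters $\gamma,\alpha$), let $\mu_n=\mu(n)$, $\ell_n=\ell(n)$, and let $p=p_c$. Then $$a_n^2\mu_n^2\sim C_\mu\,\frac{\ell_n^{1/(\gamma+1)}}{n},$$ where $C_\mu$ is a positive constant, possibly depending on the memory sequence $\{\mu_n\}$. The sequence $\{v_n\}$ is unbounded (respectively, bounded) when $\alpha+\gamma+1$ is positive (respectively, negative). Further, when $\alpha+\gamma+1>0$, $$v_n^2\sim\frac{\gamma+1}{\alpha+\gamma+1}\,a_n^2\mu_n^2\,n\log n\qquad\text{and}\qquad\sigma_n^2\sim\frac{\gamma+1}{\alpha+\gamma+1}\,n\log n.$$
   Context: Notation. $p_c=(\gamma+\frac12)/(\gamma+1)$, where $p=p_c\in[0,1]$ is a recollection probability and $\gamma>-1$; $\nu_n=\sum_{k=1}^n\mu_k$; $a_n=\prod_{i=1}^{n-1}\left(1+p\frac{\mu_{i+1}}{\nu_i}\right)^{-1}$ for $n\ge1$ (so $a_1=1$); $v_n^2=\sum_{k=1}^na_k^2\mu_k^2$ ($v_n\ge0$); $\sigma_n=v_n/(a_n\mu_n)$. $x_n\sim y_n$ means $x_n/y_n\to1$. Assumption A. $\mu_n=\mu(n)$ for a function $\mu:[1,\infty)\to(0,\infty)$ that is eventually monotone and regularly varying of index $\gamma$, and $\mu(x)=x^\gamma\ell(x)$, where: (i) for some $B>1$, $\ell(x)=f(\log x)$ for $x>e^B$, where, for some $\alpha\in\mathbb{R}$, $f:(B,\infty)\to(0,\infty)$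 is regularly varying of index $\alpha$ of the form $f(x)=x^\alpha\exp\left(\int_{\log B}^{\log x}\zeta(s)\,ds\right)$, with $\zeta$ integrable on $(\log B,x)$ for all finite $x$ and $\zeta(x)\to0$ as $x\to\infty$; (ii) $\zeta$ is of one of three types: (a) $\zeta\equiv0$; (b) $\zeta$ is nonincreasing (hence positive), regularly varying of index $-\rho$ with $\rho\in(0,1]$, $\int_{\log B}^\infty\zeta(x)\,dx=\infty$, and $\zeta$ is eventually differentiable with monotone derivative; (c) $\zeta=-\widetilde\zeta$ with $\widetilde\zeta$ satisfying the conditions in (b). *)

theory Defs
  imports "HOL-Analysis.Analysis" "HOL-Library.Landau_Symbols"
begin

text \<open>Regular variation at infinity in Karamata's sense. Measurability and positivity are only
  required near infinity, so that functions given on a half-line can be treated as total functions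
  with arbitrary values elsewhere.\<close>

definition regularly_varying :: "(real \<Rightarrow> real) \<Rightarrow> real \<Rightarrow> bool" where
  "regularly_varying f r \<longleftrightarrow>
     (\<exists>X. set_borel_measurable borel {X..} f \<and> (\<forall>x\<ge>X. f x > 0)) \<and>
     (\<forall>c>0. ((\<lambda>x. f (c * x) / f x) \<longlongrightarrow> c powr r) at_top)"

definition eventually_monotone :: "(real \<Rightarrow> real) \<Rightarrow> bool" where
  "eventually_monotone f \<longleftrightarrow> (\<exists>X. mono_on {X..} f \<or> antimono_on {X..} f)"

text \<open>Type (b) for \<open>\<zeta>\<close> on the half-line \<open>(b, \<infinity>)\<close>, where \<open>b = log B\<close>. Positivity of \<open>\<zeta>\<close> is not
  listed: it follows from monotonicity together with eventual positivity.\<close>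

definition zeta_type_b :: "real \<Rightarrow> (real \<Rightarrow> real) \<Rightarrow> bool" where
  "zeta_type_b b \<zeta> \<longleftrightarrow>
     antimono_on {b<..} \<zeta> \<and>
     (\<exists>\<rho>. 0 < \<rho> \<and> \<rho> \<le> 1 \<and> regularly_varying \<zeta> (- \<rho>)) \<and>
     filterlim (\<lambda>T. LINT s:{b<..<T}|lborel. \<zeta> s) at_top at_top \<and>
     (\<exists>X. (\<forall>x\<ge>X. \<zeta> differentiable (at x)) \<and>
          (mono_on {X..} (deriv \<zeta>) \<or> antimono_on {X..} (deriv \<zeta>)))"

definition zeta_admissible :: "real \<Rightarrow> (real \<Rightarrow> real) \<Rightarrow> bool" where
  "zeta_admissible b \<zeta> \<longleftrightarrow>
     (\<forall>x>b. set_integrable lborel {b<..<x} \<zeta>) \<and>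
     (\<zeta> \<longlongrightarrow> 0) at_top \<and>
     ((\<forall>x>b. \<zeta> x = 0) \<or> zeta_type_b b \<zeta> \<or> zeta_type_b b (\<lambda>x. - \<zeta> x))"

definition assumption_A ::
  "(real \<Rightarrow> real) \<Rightarrow> (real \<Rightarrow> real) \<Rightarrow> real \<Rightarrow> real \<Rightarrow> bool" where
  "assumption_A \<mu> L \<gamma> \<alpha> \<longleftrightarrow>
     (\<forall>x\<ge>1. \<mu> x > 0) \<and>
     eventually_monotone \<mu> \<and>
     regularly_varying \<mu> \<gamma> \<and>
     (\<forall>x\<ge>1. \<mu> x = x powr \<gamma> * L x) \<and>
     (\<exists>B f \<zeta>. B > 1 \<and>
        (\<forall>x>exp B. L x = f (ln x)) \<and>
        (\<forall>x>B. f x > 0) \<and>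
        regularly_varying f \<alpha> \<and>
        (\<forall>x>B. f x = x powr \<alpha> * exp (LINT s:{ln B<..<ln x}|lborel. \<zeta> s)) \<and>
        zeta_admissible (ln B) \<zeta>)"

text \<open>In the following, a sequence \<open>m\<close> is indexed from \<open>1\<close>; its value at \<open>0\<close> is never used.\<close>

definition mem_sum :: "(nat \<Rightarrow> real) \<Rightarrow> nat \<Rightarrow> real" where
  "mem_sum m n = (\<Sum>k=1..n. m k)"

definition a_seq :: "real \<Rightarrow> (nat \<Rightarrow> real) \<Rightarrow> nat \<Rightarrow> real" where
  "a_seq p m n = (\<Prod>i=1..<n. inverse (1 + p * (m (i + 1) / mem_sum m i)))"

definition v_seq :: "real \<Rightarrow> (nat \<Rightarrow> real) \<Rightarrow> nat \<Rightarrow> real" where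
  "v_seq p m n = sqrt (\<Sum>k=1..n. (a_seq p m k)\<^sup>2 * (m k)\<^sup>2)"

definition sigma_seq :: "real \<Rightarrow> (nat \<Rightarrow> real) \<Rightarrow> nat \<Rightarrow> real" where
  "sigma_seq p m n = v_seq p m n / (a_seq p m n * m n)"

definition p_crit :: "real \<Rightarrow> real" where
  "p_crit \<gamma> = (\<gamma> + 1/2) / (\<gamma> + 1)"

end

theory Submission
  imports Defs "HOL-Real_Asymp.Real_Asymp"
begin

text \<open>Since \<open>\<zeta>\<close> tends to \<open>0\<close>, the increments of \<open>ln (L n)\<close> are asymptotic to \<open>\<alpha>\<close> times those
  of \<open>ln (ln n)\<close>. With this, two applications of the Stolz--Cesaro theorem suffice. Comparing
  \<open>\<nu>\<^sub>n\<close> with \<open>n \<mu>\<^sub>n\<close> gives \<open>\<nu>\<^sub>n \<sim> n \<mu>\<^sub>n / (\<gamma> + 1)\<close>, while \<open>a\<^sub>n \<nu>\<^sub>n\<^sup>p\<close> converges because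
  \<open>p ln (1 + x) - ln (1 + p x) = O(x\<^sup>2)\<close> at \<open>x = \<mu>\<^sub>n\<^sub>+\<^sub>1 / \<nu>\<^sub>n = O(1/n)\<close>; at the critical \<open>p\<close>
  the powers of \<open>n\<close> in \<open>\<mu>\<^sub>n\<^sup>2 / \<nu>\<^sub>n\<^sup>2\<^sup>p\<close> combine to \<open>1/n\<close>. Comparing \<open>v\<^sub>n\<^sup>2\<close> with
  \<open>\<ell>\<^sub>n\<^sup>\<delta> ln n\<close>, where \<open>\<delta> = 1 / (\<gamma> + 1)\<close>, then gives the rest.\<close>

section \<open>The Stolz--Cesaro theorem\<close>

lemma stolz_cesaro:
  fixes x y :: "nat \<Rightarrow> real"
  assumes y: "filterlim y at_top sequentially"
    and inc: "eventually (\<lambda>n. y n < y (Suc n)) sequentially"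
    and lim: "(\<lambda>n. (x (Suc n) - x n) / (y (Suc n) - y n)) \<longlonglongrightarrow> l"
  shows "(\<lambda>n. x n / y n) \<longlonglongrightarrow> l"
proof (rule LIMSEQ_I)
  fix \<epsilon> :: real
  assume "\<epsilon> > 0"
  \<comment> \<open>Subtracting \<open>l * y\<close> reduces the claim to limit 0: eventually the
    increments of \<open>z\<close> are at most \<open>\<epsilon> / 2\<close> times those of
    \<open>y\<close>. Telescoping from \<open>N\<close> leaves a constant \<open>K\<close>, absorbed
    once \<open>y n > 2 * K / \<epsilon>\<close>.\<close>
  define z where "z = (\<lambda>n. x n - l * y n)"
  have "eventually (\<lambda>n. \<bar>z (Suc n) - z n\<bar> \<le> \<epsilon> / 2 * (y (Suc n) - y n)) sequentially"
    using inc tendstoD[OF lim half_gt_zero[OF \<open>\<epsilon> > 0\<close>]]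
  proof (eventually_elim)
    case (elim n)
    have "z (Suc n) - z n
        = ((x (Suc n) - x n) / (y (Suc n) - y n) - l) * (y (Suc n) - y n)"
      using elim(1) by (simp add: z_def field_simps)
    then show ?case
      using elim by (auto simp: dist_real_def abs_mult intro!: mult_right_mono)
  qed
  then obtain N where N: "\<bar>z (Suc n) - z n\<bar> \<le> \<epsilon> / 2 * (y (Suc n) - y n)" if "n \<ge> N" for n
    by (auto simp: eventually_sequentially)
  have z: "\<bar>z n\<bar> \<le> \<bar>z N\<bar> + \<epsilon> / 2 * (y n - y N)" if "n \<ge> N" for n
    using that
  proof (induction n rule: dec_induct)
    case (step n)
    then show ?case
      using N[of n] by (simp add: right_diff_distrib)
  qed simp
  define K where "K = \<bar>z N\<bar> + \<epsilon> / 2 * \<bar>y N\<bar>"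
  have "eventually (\<lambda>n. y n > 2 * K / \<epsilon> \<and> y n > 0) sequentially"
    using y by (auto simp: filterlim_at_top_dense eventually_conj_iff)
  then have "eventually (\<lambda>n. norm (x n / y n - l) < \<epsilon>) sequentially"
    using eventually_ge_at_top[of N]
  proof eventually_elim
    case (elim n)
    have "- (\<epsilon> / 2 * y N) \<le> \<epsilon> / 2 * \<bar>y N\<bar>"
      using \<open>\<epsilon> > 0\<close> by (simp add: abs_if)
    then have "\<bar>z n\<bar> \<le> K + \<epsilon> / 2 * y n"
      using z[of n] elim by (simp add: K_def right_diff_distrib)
    also have "K < \<epsilon> / 2 * y n"
      using elim \<open>\<epsilon> > 0\<close> by (simp add: field_simps)
    finally have "\<bar>z n\<bar> < \<epsilon> * y n" by simp
    moreover have "x n / y n - l = z n / y n"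
      using elim by (simp add: z_def field_simps)
    ultimately show ?case
      using elim by (simp add: field_simps)
  qed
  then show "\<exists>no. \<forall>n\<ge>no. norm (x n / y n - l) < \<epsilon>"
    by (simp add: eventually_sequentially)
qed

section \<open>Growth and partial sums from logarithmic increments\<close>

text \<open>A discrete substitute for regular variation: \<open>\<phi> = ln\<close> corresponds to regular variation of
  index \<open>c\<close>, and \<open>\<phi> = ln \<circ> ln\<close> to that of \<open>x \<mapsto> t (exp x)\<close>. The results \<open>sum_over_t\<close> and
  \<open>sum_bounded\<close> play the part of Karamata's theorem.\<close>

locale log_increments =
  fixes t \<phi> :: "nat \<Rightarrow> real" and c :: real
  assumes t_pos: "eventually (\<lambda>n. t n > 0) sequentially"
    and \<phi>_less: "eventually (\<lambda>n. \<phi> n < \<phi> (Suc n)) sequentially"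
    and \<phi>_small: "(\<lambda>n. \<phi> (Suc n) - \<phi> n) \<longlonglongrightarrow> 0"
    and \<phi>_top: "filterlim \<phi> at_top sequentially"
    and \<phi>_ratio: "(\<lambda>n. (\<phi> (Suc (Suc n)) - \<phi> (Suc n)) / (\<phi> (Suc n) - \<phi> n)) \<longlonglongrightarrow> 1"
    and ln_t: "(\<lambda>n. (ln (t (Suc n)) - ln (t n)) / (\<phi> (Suc n) - \<phi> n)) \<longlonglongrightarrow> c"
begin

lemma ln_t_small: "(\<lambda>n. ln (t (Suc n)) - ln (t n)) \<longlonglongrightarrow> 0"
proof -
  have "(\<lambda>n. (ln (t (Suc n)) - ln (t n)) / (\<phi> (Suc n) - \<phi> n) * (\<phi> (Suc n) - \<phi> n)) \<longlonglongrightarrow> c * 0"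
    by (intro tendsto_mult ln_t \<phi>_small)
  then have "(\<lambda>n. (ln (t (Suc n)) - ln (t n)) / (\<phi> (Suc n) - \<phi> n) * (\<phi> (Suc n) - \<phi> n)) \<longlonglongrightarrow> 0"
    by simp
  then show ?thesis
    by (rule Lim_transform_eventually) (use \<phi>_less in \<open>eventually_elim, simp\<close>)
qed

lemma t_pos_Suc: "eventually (\<lambda>n. t (Suc n) > 0) sequentially"
  using t_pos by (rule eventually_sequentially_Suc[THEN iffD2])

lemma ratio: "(\<lambda>n. t (Suc n) / t n) \<longlonglongrightarrow> 1"
proof -
  have "(\<lambda>n. exp (ln (t (Suc n)) - ln (t n))) \<longlonglongrightarrow> exp 0"
    by (intro tendsto_exp ln_t_small)
  then have "(\<lambda>n. exp (ln (t (Suc n)) - ln (t n))) \<longlonglongrightarrow> 1" by simp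
  then show ?thesis
    by (rule Lim_transform_eventually)
      (use t_pos t_pos_Suc in \<open>eventually_elim, simp add: exp_diff\<close>)
qed

text \<open>The passage from logarithmic to relative increments: \<open>t (Suc n) / t n - 1\<close>
  is \<open>exp h - 1\<close> for the logarithmic increment \<open>h\<close>, and \<open>exp\<close>
  has derivative 1 at 0.\<close>

lemma increments:
  "(\<lambda>n. (t (Suc n) - t n) / (t n * (\<phi> (Suc n) - \<phi> n))) \<longlonglongrightarrow> c"
proof -
  \<comment> \<open>Caratheodory's form of the derivative: \<open>g\<close> extends the difference
    quotient of \<open>exp\<close> continuously to 0, so nothing is divided by \<open>h n\<close>,
    which may vanish.\<close>
  obtain g :: "real \<Rightarrow> real" where g: "\<And>h. exp h - exp 0 = g h * (h - 0)" "isCont g 0" "g 0 = exp 0"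
    using DERIV_exp[of "0 :: real"] unfolding CARAT_DERIV by metis
  define h where "h = (\<lambda>n. ln (t (Suc n)) - ln (t n))"
  have "(\<lambda>n. g (h n)) \<longlonglongrightarrow> 1"
    using isCont_tendsto_compose[OF g(2) ln_t_small] g(3) by (simp add: h_def)
  then have "(\<lambda>n. g (h n) * (h n / (\<phi> (Suc n) - \<phi> n))) \<longlonglongrightarrow> 1 * c"
    using ln_t by (intro tendsto_mult) (simp_all add: h_def)
  then have "(\<lambda>n. g (h n) * (h n / (\<phi> (Suc n) - \<phi> n))) \<longlonglongrightarrow> c" by simp
  then show ?thesis
  proof (rule Lim_transform_eventually)
    show "eventually (\<lambda>n. g (h n) * (h n / (\<phi> (Suc n) - \<phi> n))
        = (t (Suc n) - t n) / (t n * (\<phi> (Suc n) - \<phi> n))) sequentially"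
      using t_pos t_pos_Suc \<phi>_less
    proof eventually_elim
      case (elim n)
      have "g (h n) * h n = t (Suc n) / t n - 1"
        using g(1)[of "h n"] elim by (simp add: h_def exp_diff)
      then have "g (h n) * (h n / (\<phi> (Suc n) - \<phi> n)) = (t (Suc n) / t n - 1) / (\<phi> (Suc n) - \<phi> n)"
        by simp
      also have "\<dots> = (t (Suc n) - t n) / (t n * (\<phi> (Suc n) - \<phi> n))"
        using elim by (simp add: diff_divide_distrib)
      finally show ?case .
    qed
  qed
qed

text \<open>Eventually each step raises \<open>ln (t n)\<close> by at least \<open>c / 2\<close>
  times the step of \<open>\<phi>\<close>; summing and exponentiating transfers the divergence of
  \<open>\<phi>\<close> to \<open>t\<close>.\<close>

lemma t_at_top:
  assumes "c > 0"
  shows "filterlim t at_top sequentially"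
proof -
  have "eventually (\<lambda>n. (ln (t (Suc n)) - ln (t n)) / (\<phi> (Suc n) - \<phi> n) > c / 2) sequentially"
    using order_tendstoD(1)[OF ln_t, of "c / 2"] assms by simp
  then have "eventually (\<lambda>n. t n > 0 \<and>
      c / 2 * (\<phi> (Suc n) - \<phi> n) \<le> ln (t (Suc n)) - ln (t n)) sequentially"
    using \<phi>_less t_pos by eventually_elim (simp add: field_simps)
  then obtain N where N: "t n > 0" "c / 2 * (\<phi> (Suc n) - \<phi> n) \<le> ln (t (Suc n)) - ln (t n)"
    if "n \<ge> N" for n
    by (auto simp: eventually_sequentially)
  have "ln (t N) + c / 2 * (\<phi> n - \<phi> N) \<le> ln (t n)" if "n \<ge> N" for n
    using that
  proof (induction n rule: dec_induct)
    case (step n)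
    then show ?case using N(2)[of n] by (simp add: right_diff_distrib)
  qed simp
  then have le: "exp (ln (t N) + c / 2 * (\<phi> n - \<phi> N)) \<le> t n" if "n \<ge> N" for n
    using that N(1)[of n] by (metis exp_le_cancel_iff exp_ln)
  have "filterlim (\<lambda>n. (ln (t N) - c / 2 * \<phi> N) + c / 2 * \<phi> n) at_top sequentially"
    using assms
    by (intro filterlim_tendsto_add_at_top[OF tendsto_const]
        filterlim_tendsto_pos_mult_at_top[OF tendsto_const _ \<phi>_top]) auto
  then have "filterlim (\<lambda>n. exp ((ln (t N) - c / 2 * \<phi> N) + c / 2 * \<phi> n)) at_top sequentially"
    by (rule filterlim_compose[OF exp_at_top])
  then show ?thesis
    by (rule filterlim_at_top_mono)
      (use le in \<open>auto simp: eventually_sequentially right_diff_distrib add_diff_eq diff_add_eq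
        intro!: exI[of _ N]\<close>)
qed

text \<open>A partial sum grows by \<open>e (Suc n)\<close> when \<open>t\<close> grows by
  \<open>t (Suc n) - t n\<close>, so the index of the normalisation must be moved by one. By
  \<open>ratio\<close> and \<open>\<phi>_ratio\<close> this costs only factors tending to 1.\<close>

lemma shifted_quotient:
  assumes "c \<noteq> 0" and e: "(\<lambda>n. e n / (t n * (\<phi> (Suc n) - \<phi> n))) \<longlonglongrightarrow> C"
  shows "(\<lambda>n. e (Suc n) / (t (Suc n) - t n)) \<longlonglongrightarrow> C / c"
proof -
  have "(\<lambda>n. e (Suc n) / (t (Suc n) * (\<phi> (Suc (Suc n)) - \<phi> (Suc n))) * (t (Suc n) / t n)
      * ((\<phi> (Suc (Suc n)) - \<phi> (Suc n)) / (\<phi> (Suc n) - \<phi> n))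
      / ((t (Suc n) - t n) / (t n * (\<phi> (Suc n) - \<phi> n)))) \<longlonglongrightarrow> C * 1 * 1 / c"
    by (intro tendsto_divide tendsto_mult LIMSEQ_Suc[OF e] ratio \<phi>_ratio increments assms)
  then have "(\<lambda>n. e (Suc n) / (t (Suc n) * (\<phi> (Suc (Suc n)) - \<phi> (Suc n))) * (t (Suc n) / t n)
      * ((\<phi> (Suc (Suc n)) - \<phi> (Suc n)) / (\<phi> (Suc n) - \<phi> n))
      / ((t (Suc n) - t n) / (t n * (\<phi> (Suc n) - \<phi> n)))) \<longlonglongrightarrow> C / c" by simp
  moreover have "eventually (\<lambda>n. \<phi> (Suc n) < \<phi> (Suc (Suc n))) sequentially"
    using \<phi>_less by (rule eventually_sequentially_Suc[THEN iffD2])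
  moreover have cancel: "x / (T' * d') * (T' / T) * (d' / d) / (D / (T * d)) = x / D"
    if "T \<noteq> 0" "T' \<noteq> 0" "d \<noteq> 0" "d' \<noteq> 0" for x T T' d d' D :: real
    using that by (simp add: divide_simps)
  ultimately show ?thesis
  proof (elim Lim_transform_eventually)
    assume "eventually (\<lambda>n. \<phi> (Suc n) < \<phi> (Suc (Suc n))) sequentially"
    then show "eventually (\<lambda>n. e (Suc n) / (t (Suc n) * (\<phi> (Suc (Suc n)) - \<phi> (Suc n))) * (t (Suc n) / t n)
        * ((\<phi> (Suc (Suc n)) - \<phi> (Suc n)) / (\<phi> (Suc n) - \<phi> n))
        / ((t (Suc n) - t n) / (t n * (\<phi> (Suc n) - \<phi> n)))
        = e (Suc n) / (t (Suc n) - t n)) sequentially"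
      using t_pos t_pos_Suc \<phi>_less by eventually_elim (rule cancel; simp)
  qed
qed

lemma sum_over_t:
  assumes "c > 0" and e: "(\<lambda>n. e n / (t n * (\<phi> (Suc n) - \<phi> n))) \<longlonglongrightarrow> C"
  shows "(\<lambda>n. (\<Sum>k=1..n. e k) / t n) \<longlonglongrightarrow> C / c"
proof (rule stolz_cesaro)
  show "eventually (\<lambda>n. t n < t (Suc n)) sequentially"
    using order_tendstoD(1)[OF increments \<open>c > 0\<close>] t_pos \<phi>_less
    by eventually_elim (simp add: zero_less_divide_iff mult_less_0_iff)
  show "(\<lambda>n. ((\<Sum>k=1..Suc n. e k) - (\<Sum>k=1..n. e k)) / (t (Suc n) - t n)) \<longlonglongrightarrow> C / c"
    using shifted_quotient[OF _ e] assms(1) by simp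
qed (rule t_at_top[OF assms(1)])

lemma sum_bounded:
  assumes "c < 0" and e: "(\<lambda>n. e n / (t n * (\<phi> (Suc n) - \<phi> n))) \<longlonglongrightarrow> C"
    and "\<And>n. n \<ge> 1 \<Longrightarrow> e n \<ge> 0"
  shows "Bseq (\<lambda>n. \<Sum>k=1..n. e k)"
proof -
  \<comment> \<open>Any positive \<open>K\<close> with \<open>- K < C / c\<close> serves. As
    \<open>c < 0\<close> makes \<open>t\<close> eventually decrease, the lower bound
    \<open>- K\<close> on the quotient becomes an upper bound on \<open>e (Suc n)\<close>.\<close>
  define K where "K = \<bar>C / c\<bar> + 1"
  have "eventually (\<lambda>n. e (Suc n) / (t (Suc n) - t n) > - K) sequentially"
  proof (rule order_tendstoD(1)[OF shifted_quotient[OF _ e]])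
    show "- K < C / c"
      unfolding K_def by linarith
  qed (use assms(1) in simp)
  then have "eventually (\<lambda>n. t n > 0 \<and> e (Suc n) \<le> K * (t n - t (Suc n))) sequentially"
    using order_tendstoD(2)[OF increments \<open>c < 0\<close>] t_pos \<phi>_less
  proof eventually_elim
    case (elim n)
    then have "t (Suc n) < t n"
      by (simp add: divide_less_0_iff mult_less_0_iff)
    then show ?case
      using elim by (simp add: field_simps)
  qed
  then obtain N where N: "t n > 0" "e (Suc n) \<le> K * (t n - t (Suc n))" if "n \<ge> N" for n
    by (auto simp: eventually_sequentially)
  \<comment> \<open>By this bound the partial sum plus \<open>K * t n\<close> is nonincreasing from
    \<open>N\<close> on, and \<open>K * t n\<close> is positive.\<close>
  have *: "(\<Sum>k=1..n. e k) + K * t n \<le> (\<Sum>k=1..N. e k) + K * t N" if "n \<ge> N" for n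
    using that
  proof (induction n rule: dec_induct)
    case (step n)
    then show ?case using N(2)[of n] by (simp add: right_diff_distrib)
  qed simp
  have "K > 0" unfolding K_def by linarith
  have "norm (\<Sum>k=1..n. e k) \<le> (\<Sum>k=1..N. e k) + K * t N" if "n \<ge> N" for n
  proof -
    have "(\<Sum>k=1..n. e k) \<ge> 0"
      by (intro sum_nonneg) (simp add: assms(3))
    moreover have "K * t n > 0"
      using N(1)[OF that] \<open>K > 0\<close> by simp
    ultimately show ?thesis
      using *[OF that] by simp
  qed
  then show ?thesis
    by (intro BfunI[where K = "(\<Sum>k=1..N. e k) + K * t N"]) (auto simp: eventually_sequentially)
qed

end

section \<open>Increments of \<open>ln (L n)\<close> under Assumption A\<close>

lemma set_integral_increment_bound:
  fixes \<zeta> :: "real \<Rightarrow> real"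
  assumes int: "set_integrable lborel {b<..<v} \<zeta>" and "b < u" "u \<le> v"
    and bound: "\<And>s. u \<le> s \<Longrightarrow> s < v \<Longrightarrow> \<bar>\<zeta> s\<bar> \<le> \<epsilon>"
  shows "\<bar>(LINT s:{b<..<v}|lborel. \<zeta> s) - (LINT s:{b<..<u}|lborel. \<zeta> s)\<bar> \<le> \<epsilon> * (v - u)"
proof -
  have split: "{b<..<v} = {b<..<u} \<union> {u..<v}"
    using assms by auto
  have int1: "set_integrable lborel {b<..<u} \<zeta>" and int2: "set_integrable lborel {u..<v} \<zeta>"
    by (rule set_integrable_subset[OF int], use assms in auto)+
  have "(LINT s:{b<..<v}|lborel. \<zeta> s)
      = (LINT s:{b<..<u}|lborel. \<zeta> s) + (LINT s:{u..<v}|lborel. \<zeta> s)"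
    unfolding split by (rule set_integral_Un) (use int1 int2 in auto)
  then have "\<bar>(LINT s:{b<..<v}|lborel. \<zeta> s) - (LINT s:{b<..<u}|lborel. \<zeta> s)\<bar>
      = \<bar>LINT s:{u..<v}|lborel. \<zeta> s\<bar>" by simp
  also have "\<dots> \<le> (LINT s:{u..<v}|lborel. \<bar>\<zeta> s\<bar>)"
    using set_integral_norm_bound[OF int2] by simp
  also have "\<dots> \<le> (LINT s:{u..<v}|lborel. \<epsilon>)"
  proof (rule set_integral_mono)
    show "set_integrable lborel {u..<v} (\<lambda>_. \<epsilon>)"
      using \<open>u \<le> v\<close> by (simp add: set_integrable_def)
  qed (use int2 bound in \<open>auto intro: set_integrable_abs\<close>)
  also have "\<dots> = \<epsilon> * (v - u)"
    using assms(3) by (simp add: set_lebesgue_integral_def)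
  finally show ?thesis .
qed


text \<open>In the scale \<open>\<phi> n = ln (ln n)\<close> the assumption reads
  \<open>ln (L n) = \<alpha> * \<phi> n + Z (\<phi> n)\<close> for large \<open>n\<close>, with
  \<open>Z\<close> the integral of \<open>\<zeta>\<close> from \<open>ln B\<close>. As
  \<open>\<zeta>\<close> tends to 0, a step of \<open>Z\<close> is negligible against one of
  \<open>\<phi>\<close>.\<close>

lemma ln_slowly_varying_increments:
  assumes "assumption_A \<mu> L \<gamma> \<alpha>"
  shows "(\<lambda>n. (ln (L (real (Suc n))) - ln (L (real n)))
      / (ln (ln (real (Suc n))) - ln (ln (real n)))) \<longlonglongrightarrow> \<alpha>"
proof -
  obtain B f \<zeta> where "B > 1"
    and L: "\<And>x. x > exp B \<Longrightarrow> L x = f (ln x)"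
    and f: "\<And>x. x > B \<Longrightarrow> f x = x powr \<alpha> * exp (LINT s:{ln B<..<ln x}|lborel. \<zeta> s)"
    and \<zeta>: "zeta_admissible (ln B) \<zeta>"
    using assms unfolding assumption_A_def by metis
  have int: "set_integrable lborel {ln B<..<x} \<zeta>" if "x > ln B" for x
    using \<zeta> that by (simp add: zeta_admissible_def)
  have \<zeta>0: "(\<zeta> \<longlongrightarrow> 0) at_top"
    using \<zeta> by (simp add: zeta_admissible_def)
  define Z where "Z = (\<lambda>y. LINT s:{ln B<..<y}|lborel. \<zeta> s)"
  define \<phi> where "\<phi> = (\<lambda>n. ln (ln (real n)))"
  have large: "eventually (\<lambda>n. real n > exp B) sequentially"
    by real_asymp
  have ln_L: "ln (L (real n)) = \<alpha> * \<phi> n + Z (\<phi> n)" and \<phi>_gt: "\<phi> n > ln B"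
    and \<phi>_less: "\<phi> n < \<phi> (Suc n)" if "real n > exp B" for n
  proof -
    have "real n > 0"
      using that exp_gt_zero[of B] by linarith
    then have "ln (real n) > B"
      using that by (metis ln_exp ln_less_cancel_iff exp_gt_zero)
    then have "ln (real n) > 0"
      using \<open>B > 1\<close> by linarith
    show "ln (L (real n)) = \<alpha> * \<phi> n + Z (\<phi> n)"
      unfolding L[OF that] f[OF \<open>ln (real n) > B\<close>]
      using \<open>ln (real n) > 0\<close> by (subst ln_mult) (simp_all add: ln_powr \<phi>_def Z_def)
    show "\<phi> n > ln B"
      unfolding \<phi>_def using \<open>B > 1\<close> \<open>ln (real n) > B\<close> by (subst ln_less_cancel_iff) auto
    have "ln (real n) < ln (real (Suc n))"
      using \<open>real n > 0\<close> by simp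
    then show "\<phi> n < \<phi> (Suc n)"
      unfolding \<phi>_def using \<open>ln (real n) > 0\<close> by (subst ln_less_cancel_iff) linarith+
  qed
  have \<phi>_top: "filterlim \<phi> at_top sequentially"
    unfolding \<phi>_def by real_asymp
  have "(\<lambda>n. (Z (\<phi> (Suc n)) - Z (\<phi> n)) / (\<phi> (Suc n) - \<phi> n)) \<longlonglongrightarrow> 0"
  proof (rule LIMSEQ_I)
    fix \<epsilon> :: real
    assume "\<epsilon> > 0"
    obtain S where S: "\<And>s. s \<ge> S \<Longrightarrow> \<bar>\<zeta> s\<bar> < \<epsilon> / 2"
      using tendstoD[OF \<zeta>0 half_gt_zero[OF \<open>\<epsilon> > 0\<close>]] by (auto simp: eventually_at_top_linorder)
    have "eventually (\<lambda>n. \<phi> n \<ge> S) sequentially"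
      using \<phi>_top by (simp add: filterlim_at_top)
    then have "eventually (\<lambda>n. norm ((Z (\<phi> (Suc n)) - Z (\<phi> n)) / (\<phi> (Suc n) - \<phi> n) - 0) < \<epsilon>) sequentially"
      using large
    proof eventually_elim
      case (elim n)
      have "\<bar>Z (\<phi> (Suc n)) - Z (\<phi> n)\<bar> \<le> \<epsilon> / 2 * (\<phi> (Suc n) - \<phi> n)"
        unfolding Z_def
      proof (rule set_integral_increment_bound)
        show "\<bar>\<zeta> s\<bar> \<le> \<epsilon> / 2" if "\<phi> n \<le> s" for s
          using S[of s] that elim by simp
      qed (use int \<phi>_gt[of n] \<phi>_less[of n] elim in auto)
      also have "\<dots> < \<epsilon> * (\<phi> (Suc n) - \<phi> n)"
        using \<phi>_less[of n] elim \<open>\<epsilon> > 0\<close> by simp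
      finally show ?case
        using \<phi>_less[of n] elim by (simp add: abs_divide divide_less_eq)
    qed
    then show "\<exists>no. \<forall>n\<ge>no. norm ((Z (\<phi> (Suc n)) - Z (\<phi> n)) / (\<phi> (Suc n) - \<phi> n) - 0) < \<epsilon>"
      by (simp add: eventually_sequentially)
  qed
  then have "(\<lambda>n. \<alpha> + (Z (\<phi> (Suc n)) - Z (\<phi> n)) / (\<phi> (Suc n) - \<phi> n)) \<longlonglongrightarrow> \<alpha> + 0"
    by (intro tendsto_add tendsto_const)
  then have "(\<lambda>n. \<alpha> + (Z (\<phi> (Suc n)) - Z (\<phi> n)) / (\<phi> (Suc n) - \<phi> n)) \<longlonglongrightarrow> \<alpha>"
    by simp
  then show ?thesis
  proof (rule Lim_transform_eventually)
    show "eventually (\<lambda>n. \<alpha> + (Z (\<phi> (Suc n)) - Z (\<phi> n)) / (\<phi> (Suc n) - \<phi> n)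
        = (ln (L (real (Suc n))) - ln (L (real n)))
          / (ln (ln (real (Suc n))) - ln (ln (real n)))) sequentially"
      using large
    proof eventually_elim
      case (elim n)
      have "ln (L (real (Suc n))) - ln (L (real n))
          = \<alpha> * (\<phi> (Suc n) - \<phi> n) + (Z (\<phi> (Suc n)) - Z (\<phi> n))"
        using ln_L[of n] ln_L[of "Suc n"] elim by (simp add: right_diff_distrib)
      then show ?case
        using \<phi>_less[OF elim] by (simp add: add_divide_distrib \<phi>_def del: of_nat_Suc ln_less_cancel_iff)
    qed
  qed
qed

section \<open>Convergence of \<open>a_seq p m n * mem_sum m n powr p\<close>\<close>

lemma ln_one_plus_scaled_bound:
  fixes p x :: real
  assumes "0 \<le> p" "p \<le> 1" "0 \<le> x"
  shows "\<bar>p * ln (1 + x) - ln (1 + p * x)\<bar> \<le> x\<^sup>2"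
proof -
  have lower: "y - y\<^sup>2 \<le> ln (1 + y)" if "y \<ge> 0" for y :: real
  proof (cases "y \<le> 1")
    case True
    then show ?thesis using ln_one_plus_pos_lower_bound that by blast
  next
    case False
    then have "y * 1 \<le> y * y" by (intro mult_left_mono) auto
    moreover have "ln (1 + y) \<ge> 0" using False by simp
    ultimately show ?thesis by (simp add: power2_eq_square)
  qed
  \<comment> \<open>Both logarithmic terms are squeezed between \<open>p * x - x\<^sup>2\<close> and
    \<open>p * x\<close>.\<close>
  have "p * ln (1 + x) \<le> p * x"
    using assms by (intro mult_left_mono ln_add_one_self_le_self)
  moreover have "p * (x - x\<^sup>2) \<le> p * ln (1 + x)"
    using assms by (intro mult_left_mono lower)
  moreover have "ln (1 + p * x) \<le> p * x" "p * x - (p * x)\<^sup>2 \<le> ln (1 + p * x)"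
    using assms by (auto intro: lower ln_add_one_self_le_self)
  moreover have "p * x\<^sup>2 \<le> x\<^sup>2"
    using assms by (simp add: mult_left_le_one_le)
  moreover have "(p * x)\<^sup>2 \<le> x\<^sup>2"
    using assms by (intro power_mono) (auto simp: mult_left_le_one_le)
  ultimately show ?thesis
    by (simp add: right_diff_distrib abs_le_iff)
qed

text \<open>Since \<open>mem_sum m (Suc n) = mem_sum m n * (1 + x n)\<close>, each step multiplies
  the product by \<open>exp (d n)\<close>. The \<open>d n\<close> are dominated by
  \<open>(x n)\<^sup>2\<close>, hence summable, and the limit is positive because it contains only a
  positive power and an exponential.\<close>

lemma a_seq_times_mem_sum_powr:
  assumes "0 \<le> p" "p \<le> 1" and m: "\<And>n. n \<ge> 1 \<Longrightarrow> m n > 0"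
    and summ: "summable (\<lambda>n. (m (Suc n) / mem_sum m n)\<^sup>2)"
  shows "\<exists>C>0. (\<lambda>n. a_seq p m n * mem_sum m n powr p) \<longlonglongrightarrow> C"
proof -
  define x where "x = (\<lambda>n. m (Suc n) / mem_sum m n)"
  define d where "d = (\<lambda>n. p * ln (1 + x n) - ln (1 + p * x n))"
  have pos: "mem_sum m n > 0" if "n \<ge> 1" for n
    unfolding mem_sum_def using that m by (intro sum_pos) auto
  have x_nonneg: "x n \<ge> 0" for n
    using pos[of n] m[of "Suc n"] by (cases "n = 0") (auto simp: x_def mem_sum_def)
  \<comment> \<open>\<open>x 0 = m 1 / 0 = 0\<close>, so the sums below may start at \<open>0\<close> although the product starts at \<open>1\<close>.\<close>
  have "d 0 = 0"
    by (simp add: d_def x_def mem_sum_def)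
  have "summable d"
  proof (rule summable_comparison_test')
    show "summable (\<lambda>n. (x n)\<^sup>2)"
      using summ by (simp add: x_def)
    show "norm (d n) \<le> (x n)\<^sup>2" if "n \<ge> 0" for n
      using ln_one_plus_scaled_bound[OF assms(1,2) x_nonneg] by (simp add: d_def)
  qed
  then have "(\<lambda>n. \<Sum>i<n. d i) \<longlonglongrightarrow> suminf d"
    by (rule summable_LIMSEQ)
  then have lim: "(\<lambda>n. mem_sum m 1 powr p * exp (\<Sum>i<n. d i)) \<longlonglongrightarrow> mem_sum m 1 powr p * exp (suminf d)"
    by (intro tendsto_intros)
  have *: "a_seq p m n * mem_sum m n powr p = mem_sum m 1 powr p * exp (\<Sum>i<n. d i)" if "n \<ge> 1" for n
    using that
  proof (induction n rule: dec_induct)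
    case base
    then show ?case by (simp add: a_seq_def \<open>d 0 = 0\<close>)
  next
    case (step n)
    have "1 + p * x n > 0" "1 + x n > 0"
      using x_nonneg[of n] assms(1) by (auto intro: add_pos_nonneg)
    then have exp_d: "exp (d n) = (1 + x n) powr p / (1 + p * x n)"
      by (simp add: d_def exp_diff powr_def)
    have "mem_sum m (Suc n) = mem_sum m n * (1 + x n)"
      using pos[of n] step(1) by (simp add: x_def distrib_left) (simp add: mem_sum_def)
    moreover have "a_seq p m (Suc n) = a_seq p m n / (1 + p * x n)"
      using step(1) by (simp add: a_seq_def x_def field_simps)
    ultimately have "a_seq p m (Suc n) * mem_sum m (Suc n) powr p
        = a_seq p m n * mem_sum m n powr p * exp (d n)"
      using pos[of n] step(1) \<open>1 + x n > 0\<close> by (simp add: exp_d powr_mult)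
    then show ?case
      using step by (simp add: exp_add)
  qed
  have "(\<lambda>n. a_seq p m n * mem_sum m n powr p) \<longlonglongrightarrow> mem_sum m 1 powr p * exp (suminf d)"
    by (rule Lim_transform_eventually[OF lim])
      (use * in \<open>auto simp: eventually_sequentially intro!: exI[of _ 1]\<close>)
  then show ?thesis
    using pos[of 1] by (intro exI[of _ "mem_sum m 1 powr p * exp (suminf d)"]) auto
qed


section \<open>Asymptotics at the critical recollection probability\<close>

theorem theorem4p8:
  fixes \<mu> L :: "real \<Rightarrow> real" and \<gamma> \<alpha> p :: real and m :: "nat \<Rightarrow> real"
  assumes "\<gamma> > -1"
    and "assumption_A \<mu> L \<gamma> \<alpha>"
    and "m = (\<lambda>n. \<mu> (real n))"
    and "p = p_crit \<gamma>" and "0 \<le> p" and "p \<le> 1"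
  shows "(\<exists>C>0. (\<lambda>n. (a_seq p m n)\<^sup>2 * (m n)\<^sup>2)
                  \<sim>[sequentially] (\<lambda>n. C * (L (real n) powr (1 / (\<gamma> + 1)) / real n)))
    \<and> (\<alpha> + \<gamma> + 1 > 0 \<longrightarrow> \<not> Bseq (v_seq p m))
    \<and> (\<alpha> + \<gamma> + 1 < 0 \<longrightarrow> Bseq (v_seq p m))
    \<and> (\<alpha> + \<gamma> + 1 > 0 \<longrightarrow>
         (\<lambda>n. (v_seq p m n)\<^sup>2) \<sim>[sequentially]
           (\<lambda>n. (\<gamma> + 1) / (\<alpha> + \<gamma> + 1) * (a_seq p m n)\<^sup>2 * (m n)\<^sup>2 * real n * ln (real n))
       \<and> (\<lambda>n. (sigma_seq p m n)\<^sup>2) \<sim>[sequentially]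
           (\<lambda>n. (\<gamma> + 1) / (\<alpha> + \<gamma> + 1) * real n * ln (real n)))"
proof -
  \<comment> \<open>\<open>\<delta>\<close> is the exponent of \<open>L\<close> in the first
    asymptotic. \<open>c\<close> is the index of \<open>L powr \<delta> * ln n\<close> in the scale
    \<open>ln (ln n)\<close> and has the sign of \<open>\<alpha> + \<gamma> + 1\<close>.\<close>
  define \<delta> where "\<delta> = 1 / (\<gamma> + 1)"
  define c where "c = \<delta> * \<alpha> + 1"
  have \<gamma>1: "\<gamma> + 1 > 0"
    using assms(1) by simp
  have c_eq: "c = (\<alpha> + \<gamma> + 1) / (\<gamma> + 1)"
    using \<gamma>1 by (simp add: c_def \<delta>_def field_simps)
  have p_\<delta>: "2 - 2 * p = \<delta>" and p_\<gamma>: "2 * p * (\<gamma> + 1) = 2 * \<gamma> + 1"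
    using \<gamma>1 by (simp_all add: assms(4) p_crit_def \<delta>_def field_simps)
  have m_pos: "m n > 0" and m_eq: "m n = real n powr \<gamma> * L (real n)" if "n \<ge> 1" for n
    using assms(2) that by (auto simp: assms(3) assumption_A_def)
  have L_pos: "L (real n) > 0" if "n \<ge> 1" for n
    using m_pos[OF that] m_eq[OF that] by (simp add: zero_less_mult_iff)
  have ge1: "eventually (\<lambda>n::nat. n \<ge> 1) sequentially"
    by (rule eventually_ge_at_top)
  \<comment> \<open>As 3 exceeds e, \<open>ln n > 1\<close> from here on, which keeps
    \<open>ln (ln n)\<close> positive and strictly increasing.\<close>
  have ge3: "eventually (\<lambda>n::nat. n \<ge> 3) sequentially"
    by (rule eventually_ge_at_top)
  have ln_gt1: "ln (real n) > 1" if "n \<ge> 3" for n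
  proof -
    have "exp 1 < real n"
      using exp_le that e_less_272 by linarith
    then show ?thesis
      by (metis exp_gt_zero ln_exp ln_less_cancel_iff order_less_trans)
  qed

  have ln_L: "(\<lambda>n. (ln (L (real (Suc n))) - ln (L (real n)))
      / (ln (ln (real (Suc n))) - ln (ln (real n)))) \<longlonglongrightarrow> \<alpha>"
    using ln_slowly_varying_increments[OF assms(2)] .

  interpret S: log_increments "\<lambda>n. real n * m n" "\<lambda>n. ln (real n)" "\<gamma> + 1"
  proof
    show "eventually (\<lambda>n. real n * m n > 0) sequentially"
      using ge1 by eventually_elim (simp add: m_pos)
    show "eventually (\<lambda>n. ln (real n) < ln (real (Suc n))) sequentially"
      using ge1 by eventually_elim simp
    show "(\<lambda>n. ln (real (Suc n)) - ln (real n)) \<longlonglongrightarrow> 0"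
      "filterlim (\<lambda>n. ln (real n)) at_top sequentially"
      "(\<lambda>n. (ln (real (Suc (Suc n))) - ln (real (Suc n))) / (ln (real (Suc n)) - ln (real n))) \<longlonglongrightarrow> 1"
      by real_asymp+
    \<comment> \<open>Increments of \<open>ln (ln n)\<close> are negligible against those of
      \<open>ln n\<close>, so the factor \<open>L\<close> adds only \<open>\<alpha> * 0\<close> to
      the index of \<open>n * m n\<close>.\<close>
    have "(\<lambda>n. (ln (ln (real (Suc n))) - ln (ln (real n))) / (ln (real (Suc n)) - ln (real n))) \<longlonglongrightarrow> 0"
      by real_asymp
    then have "(\<lambda>n. (\<gamma> + 1) + (ln (L (real (Suc n))) - ln (L (real n)))
        / (ln (ln (real (Suc n))) - ln (ln (real n)))
        * ((ln (ln (real (Suc n))) - ln (ln (real n))) / (ln (real (Suc n)) - ln (real n)))) \<longlonglongrightarrow> \<gamma> + 1 + \<alpha> * 0"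
      by (intro tendsto_add tendsto_mult tendsto_const ln_L)
    then have "(\<lambda>n. (\<gamma> + 1) + (ln (L (real (Suc n))) - ln (L (real n)))
        / (ln (ln (real (Suc n))) - ln (ln (real n)))
        * ((ln (ln (real (Suc n))) - ln (ln (real n))) / (ln (real (Suc n)) - ln (real n)))) \<longlonglongrightarrow> \<gamma> + 1"
      by simp
    then show "(\<lambda>n. (ln (real (Suc n) * m (Suc n)) - ln (real n * m n))
        / (ln (real (Suc n)) - ln (real n))) \<longlonglongrightarrow> \<gamma> + 1"
    proof (rule Lim_transform_eventually)
      show "eventually (\<lambda>n. (\<gamma> + 1) + (ln (L (real (Suc n))) - ln (L (real n)))
          / (ln (ln (real (Suc n))) - ln (ln (real n)))
          * ((ln (ln (real (Suc n))) - ln (ln (real n))) / (ln (real (Suc n)) - ln (real n)))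
          = (ln (real (Suc n) * m (Suc n)) - ln (real n * m n))
          / (ln (real (Suc n)) - ln (real n))) sequentially"
        using ge3
      proof eventually_elim
        case (elim n)
        have ln_s: "ln (real k * m k) = (\<gamma> + 1) * ln (real k) + ln (L (real k))" if "k \<ge> 1" for k
          using that L_pos[OF that] by (simp add: m_eq ln_mult ln_powr algebra_simps)
        have "ln (real n) < ln (real (Suc n))" "ln (real n) > 1"
          using elim ln_gt1 by simp_all
        then have "ln (ln (real n)) < ln (ln (real (Suc n)))"
          by (subst ln_less_cancel_iff) linarith+
        have cancel: "A + X / D * (D / E) = (A * E + X) / E" if "D \<noteq> 0" "E \<noteq> 0" for A X D E :: real
          using that by (simp add: field_simps)
        have "ln (real (Suc n) * m (Suc n)) - ln (real n * m n) = (\<gamma> + 1) * (ln (real (Suc n)) - ln (real n))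
            + (ln (L (real (Suc n))) - ln (L (real n)))"
          using ln_s[of n] ln_s[of "Suc n"] elim by (simp add: right_diff_distrib)
        then show ?case
          using \<open>ln (ln (real n)) < _\<close> \<open>ln (real n) < _\<close>
          by (subst cancel) simp_all
      qed
    qed
  qed

  have "(\<lambda>n. 1 / (real n * (ln (real (Suc n)) - ln (real n)))) \<longlonglongrightarrow> 1"
    by real_asymp
  then have "(\<lambda>n. m n / (real n * m n * (ln (real (Suc n)) - ln (real n)))) \<longlonglongrightarrow> 1"
    by (rule Lim_transform_eventually) (rule eventually_mono[OF ge1], use m_pos in force)
  then have sum_m: "(\<lambda>n. mem_sum m n / (real n * m n)) \<longlonglongrightarrow> 1 / (\<gamma> + 1)"
    unfolding mem_sum_def by (intro S.sum_over_t \<gamma>1)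
  have mem_pos: "mem_sum m n > 0" if "n \<ge> 1" for n
    unfolding mem_sum_def using that m_pos by (intro sum_pos) auto

  have "summable (\<lambda>n. (m (Suc n) / mem_sum m n)\<^sup>2)"
  proof (rule summable_comparison_test_ev)
    have "(\<lambda>n. real n / real (Suc n)) \<longlonglongrightarrow> 1"
      by real_asymp
    \<comment> \<open>This is \<open>m (Suc n) / mem_sum m n * n\<close>, split into factors with
      known limits. It tends to \<open>\<gamma> + 1\<close>; \<open>\<gamma> + 2\<close> below is
      simply a number above this limit.\<close>
    then have "(\<lambda>n. (real (Suc n) * m (Suc n) / (real n * m n)) * (real n / real (Suc n))
        / (mem_sum m n / (real n * m n))) \<longlonglongrightarrow> 1 * 1 / (1 / (\<gamma> + 1))"
      using \<gamma>1 by (intro tendsto_divide tendsto_mult S.ratio sum_m) auto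
    then have "eventually (\<lambda>n. (real (Suc n) * m (Suc n) / (real n * m n)) * (real n / real (Suc n))
        / (mem_sum m n / (real n * m n)) < \<gamma> + 2) sequentially"
      by (rule order_tendstoD) simp
    then show "eventually (\<lambda>n. norm ((m (Suc n) / mem_sum m n)\<^sup>2) \<le> (\<gamma> + 2)\<^sup>2 * (1 / real n ^ 2)) sequentially"
      using ge1
    proof eventually_elim
      case (elim n)
      have "(real (Suc n) * m (Suc n) / (real n * m n)) * (real n / real (Suc n))
        / (mem_sum m n / (real n * m n)) = m (Suc n) / mem_sum m n * real n"
        using elim m_pos[of n] mem_pos[of n] by (simp add: divide_simps)
      then have "m (Suc n) / mem_sum m n * real n \<le> \<gamma> + 2"
        using elim(1) by linarith
      then have "m (Suc n) / mem_sum m n \<le> (\<gamma> + 2) / real n"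
        using elim(2) by (subst pos_le_divide_eq) auto
      then have "(m (Suc n) / mem_sum m n)\<^sup>2 \<le> ((\<gamma> + 2) / real n)\<^sup>2"
        using elim m_pos[of "Suc n"] mem_pos[of n] by (intro power_mono) auto
      then show ?case
        by (simp add: power_divide)
    qed
    show "summable (\<lambda>n. (\<gamma> + 2)\<^sup>2 * (1 / real n ^ 2))"
      using inverse_power_summable[of 2, where ?'a = real]
      by (intro summable_mult) (simp add: inverse_eq_divide)
  qed
  then obtain C0 where "C0 > 0"
    and C0: "(\<lambda>n. a_seq p m n * mem_sum m n powr p) \<longlonglongrightarrow> C0"
    using a_seq_times_mem_sum_powr[where m = m, OF assms(5,6) m_pos] by blast

  \<comment> \<open>Asymptotics of \<open>a_n^2 \<mu>_n^2\<close>\<close>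
  define w where "w = (\<lambda>n. (a_seq p m n)\<^sup>2 * (m n)\<^sup>2)"
  \<comment> \<open>\<open>C\<close> arises from \<open>C0\<^sup>2\<close> when
    \<open>mem_sum m n\<close> is replaced by its asymptotic
    \<open>n * m n / (\<gamma> + 1)\<close>. What then remains of \<open>w n\<close> is
    \<open>(m n)\<^sup>2 / (n * m n) powr (2 * p)\<close>.\<close>
  define C where "C = C0\<^sup>2 / (1 / (\<gamma> + 1)) powr (2 * p)"
  have "C > 0"
    using \<open>C0 > 0\<close> \<gamma>1 by (simp add: C_def)
  have "(\<lambda>n. (a_seq p m n * mem_sum m n powr p)\<^sup>2 / (mem_sum m n / (real n * m n)) powr (2 * p)) \<longlonglongrightarrow> C"
    unfolding C_def using \<gamma>1
    by (intro tendsto_divide tendsto_power C0 tendsto_powr sum_m tendsto_const) auto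
  then have w_lim: "(\<lambda>n. w n / (L (real n) powr \<delta> / real n)) \<longlonglongrightarrow> C"
  proof (rule Lim_transform_eventually)
    show "eventually (\<lambda>n. (a_seq p m n * mem_sum m n powr p)\<^sup>2 / (mem_sum m n / (real n * m n)) powr (2 * p)
        = w n / (L (real n) powr \<delta> / real n)) sequentially"
      using ge1
    proof eventually_elim
      case (elim n)
      have square: "(y powr r)\<^sup>2 = y powr (2 * r)" if "y > 0" for y r :: real
        using that by (simp add: powr_powr mult.commute flip: powr_numeral)
      \<comment> \<open>The critical \<open>p\<close> enters here: by \<open>p_\<gamma>\<close> the
        exponents of \<open>n\<close> add up to \<open>2 * \<gamma>\<close>, and by
        \<open>p_\<delta>\<close> those of \<open>L\<close> to 2.\<close>
      have "(real n * m n) powr (2 * p) * (L (real n) powr \<delta> / real n)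
          = real n powr (2 * p * (\<gamma> + 1)) * real n powr (-1) * (L (real n) powr (2 * p) * L (real n) powr \<delta>)"
        using elim L_pos[OF elim]
        by (simp add: m_eq powr_mult powr_powr powr_add powr_minus divide_inverse algebra_simps)
      also have "\<dots> = real n powr (2 * \<gamma>) * L (real n) powr 2"
        unfolding powr_add[symmetric] p_\<gamma> p_\<delta>[symmetric] by simp
      also have "\<dots> = (m n)\<^sup>2"
        using elim L_pos[OF elim] by (simp add: m_eq power_mult_distrib square)
      finally have "(real n * m n) powr (2 * p) = (m n)\<^sup>2 / (L (real n) powr \<delta> / real n)"
        using elim L_pos[OF elim] by (simp add: field_simps)
      then show ?case
        using elim m_pos[OF elim] mem_pos[OF elim]
        by (simp add: powr_divide power_mult_distrib square w_def)
    qed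
  qed

  interpret T: log_increments "\<lambda>n. L (real n) powr \<delta> * ln (real n)" "\<lambda>n. ln (ln (real n))" c
  proof
    show "eventually (\<lambda>n. L (real n) powr \<delta> * ln (real n) > 0) sequentially"
      using ge3
    proof eventually_elim
      case (elim n)
      then show ?case
        using L_pos[of n] ln_gt1[of n] by (intro mult_pos_pos) auto
    qed
    have less: "ln (ln (real n)) < ln (ln (real (Suc n)))" if "n \<ge> 3" for n
      using ln_gt1[OF that] that by (subst ln_less_cancel_iff) (auto simp del: of_nat_Suc)
    then show "eventually (\<lambda>n. ln (ln (real n)) < ln (ln (real (Suc n)))) sequentially"
      by (rule eventually_mono[OF ge3])
    show "(\<lambda>n. ln (ln (real (Suc n))) - ln (ln (real n))) \<longlonglongrightarrow> 0"
      "filterlim (\<lambda>n. ln (ln (real n))) at_top sequentially"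
      "(\<lambda>n. (ln (ln (real (Suc (Suc n)))) - ln (ln (real (Suc n))))
          / (ln (ln (real (Suc n))) - ln (ln (real n)))) \<longlonglongrightarrow> 1"
      by real_asymp+
    \<comment> \<open>In the scale \<open>ln (ln n)\<close> the factor
      \<open>L powr \<delta>\<close> contributes \<open>\<delta> * \<alpha>\<close> to the index and
      the factor \<open>ln n\<close> contributes 1.\<close>
    have "(\<lambda>n. \<delta> * ((ln (L (real (Suc n))) - ln (L (real n)))
        / (ln (ln (real (Suc n))) - ln (ln (real n)))) + 1) \<longlonglongrightarrow> c"
      unfolding c_def by (intro tendsto_intros ln_L)
    then show "(\<lambda>n. (ln (L (real (Suc n)) powr \<delta> * ln (real (Suc n))) - ln (L (real n) powr \<delta> * ln (real n)))
        / (ln (ln (real (Suc n))) - ln (ln (real n)))) \<longlonglongrightarrow> c"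
    proof (rule Lim_transform_eventually)
      show "eventually (\<lambda>n. \<delta> * ((ln (L (real (Suc n))) - ln (L (real n)))
          / (ln (ln (real (Suc n))) - ln (ln (real n)))) + 1
          = (ln (L (real (Suc n)) powr \<delta> * ln (real (Suc n))) - ln (L (real n) powr \<delta> * ln (real n)))
          / (ln (ln (real (Suc n))) - ln (ln (real n)))) sequentially"
        using ge3
      proof eventually_elim
        case (elim n)
        have "ln (L (real k) powr \<delta> * ln (real k)) = \<delta> * ln (L (real k)) + ln (ln (real k))" if "k \<ge> 3" for k
          using L_pos[of k] ln_gt1[of k] that by (simp add: ln_mult)
        then have "ln (L (real (Suc n)) powr \<delta> * ln (real (Suc n))) - ln (L (real n) powr \<delta> * ln (real n))
            = \<delta> * (ln (L (real (Suc n))) - ln (L (real n))) + (ln (ln (real (Suc n))) - ln (ln (real n)))"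
          using elim by (simp add: right_diff_distrib del: of_nat_Suc)
        moreover have cancel: "A * (X / D) + 1 = (A * X + D) / D" if "D \<noteq> 0" for A X D :: real
          using that by (simp add: add_divide_distrib)
        ultimately show ?case
          using less[OF elim] by (subst cancel) simp_all
      qed
    qed
  qed

  \<comment> \<open>Increments of \<open>ln (ln n)\<close> are asymptotic to
    \<open>1 / (n * ln n)\<close>, which turns \<open>w_lim\<close> into the hypothesis on
    \<open>e\<close> shared by \<open>T.sum_over_t\<close> and \<open>T.sum_bounded\<close>.\<close>
  have "(\<lambda>n. 1 / (real n * ln (real n) * (ln (ln (real (Suc n))) - ln (ln (real n))))) \<longlonglongrightarrow> 1"
    by real_asymp
  then have "(\<lambda>n. w n / (L (real n) powr \<delta> / real n) *
      (1 / (real n * ln (real n) * (ln (ln (real (Suc n))) - ln (ln (real n)))))) \<longlonglongrightarrow> C * 1"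
    by (intro tendsto_mult w_lim)
  then have "(\<lambda>n. w n / (L (real n) powr \<delta> / real n) *
      (1 / (real n * ln (real n) * (ln (ln (real (Suc n))) - ln (ln (real n)))))) \<longlonglongrightarrow> C"
    by simp
  then have w_T: "(\<lambda>n. w n / (L (real n) powr \<delta> * ln (real n)
      * (ln (ln (real (Suc n))) - ln (ln (real n))))) \<longlonglongrightarrow> C"
    by (rule Lim_transform_eventually) (use ge1 in \<open>eventually_elim, simp\<close>)

  \<comment> \<open>Growth or boundedness of \<open>v_n\<close> and
    \<open>\<sigma>_n\<close>\<close>
  define V where "V = (\<lambda>n. \<Sum>k=1..n. w k)"
  have V_nonneg: "V n \<ge> 0" for n
    unfolding V_def w_def by (intro sum_nonneg) auto
  have v: "v_seq p m n = sqrt (V n)" for n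
    by (simp add: v_seq_def V_def w_def)
  have w_pos: "w n > 0" if "n \<ge> 1" for n
  proof -
    have "a_seq p m n > 0"
      unfolding a_seq_def
      using assms(5) m_pos mem_pos
      by (intro prod_pos ballI positive_imp_inverse_positive add_pos_nonneg mult_nonneg_nonneg
          divide_nonneg_nonneg) (auto intro: less_imp_le)
    then show ?thesis
      using m_pos[OF that] by (simp add: w_def)
  qed

  have "w \<sim>[sequentially] (\<lambda>n. C * (L (real n) powr \<delta> / real n))"
  proof (rule asymp_equivI')
    have "(\<lambda>n. w n / (L (real n) powr \<delta> / real n) / C) \<longlonglongrightarrow> C / C"
      using \<open>C > 0\<close> by (intro tendsto_divide w_lim) auto
    then show "(\<lambda>n. w n / (C * (L (real n) powr \<delta> / real n))) \<longlonglongrightarrow> 1"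
      using \<open>C > 0\<close> by (simp add: mult.commute)
  qed
  moreover have "\<not> Bseq (v_seq p m)"
    and v_asymp: "(\<lambda>n. (v_seq p m n)\<^sup>2) \<sim>[sequentially] (\<lambda>n. 1 / c * w n * real n * ln (real n))"
    if "c > 0"
  proof -
    have V_lim: "(\<lambda>n. V n / (L (real n) powr \<delta> * ln (real n))) \<longlonglongrightarrow> C / c"
      unfolding V_def by (rule T.sum_over_t[OF that w_T])
    have "filterlim (\<lambda>n. V n / (L (real n) powr \<delta> * ln (real n)) * (L (real n) powr \<delta> * ln (real n)))
        at_top sequentially"
      by (rule filterlim_tendsto_pos_mult_at_top[OF V_lim _ T.t_at_top[OF that]])
        (use that \<open>C > 0\<close> in simp)
    moreover have "eventually (\<lambda>n. V n / (L (real n) powr \<delta> * ln (real n)) * (L (real n) powr \<delta> * ln (real n)) = V n)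
        sequentially"
      using T.t_pos by eventually_elim (use less_irrefl in fastforce)
    ultimately have "filterlim V at_top sequentially"
      by (simp cong: filterlim_cong)
    then have "filterlim (v_seq p m) at_top sequentially"
      unfolding v by (rule filterlim_compose[OF sqrt_at_top])
    then have v_large: "eventually (\<lambda>n. v_seq p m n > K) sequentially" for K
      by (simp add: filterlim_at_top_dense)
    show "\<not> Bseq (v_seq p m)"
    proof
      assume "Bseq (v_seq p m)"
      then obtain K where "\<And>n. norm (v_seq p m n) \<le> K"
        by (auto simp: Bseq_def)
      moreover obtain n where "v_seq p m n > K"
        using v_large[of K] by (auto simp: eventually_sequentially)
      ultimately show False
        by (smt (verit) real_norm_def)
    qed
    \<comment> \<open>Dividing \<open>V_lim\<close> by \<open>w_lim\<close> cancels
      \<open>L powr \<delta>\<close> from the quotient and \<open>C\<close> from its limit, leaving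
      \<open>V n / (w n * n * ln n)\<close> with limit \<open>1 / c\<close>.\<close>
    have "(\<lambda>n. V n / (L (real n) powr \<delta> * ln (real n)) / (w n / (L (real n) powr \<delta> / real n)) * c)
        \<longlonglongrightarrow> C / c / C * c"
      using \<open>C > 0\<close> by (intro tendsto_mult tendsto_divide V_lim w_lim tendsto_const) auto
    then have "(\<lambda>n. V n / (L (real n) powr \<delta> * ln (real n)) / (w n / (L (real n) powr \<delta> / real n)) * c)
        \<longlonglongrightarrow> 1"
      using \<open>C > 0\<close> that by simp
    then have "(\<lambda>n. V n / (1 / c * w n * real n * ln (real n))) \<longlonglongrightarrow> 1"
    proof (rule Lim_transform_eventually)
      have "V n / (L (real n) powr \<delta> * ln (real n)) / (w n / (L (real n) powr \<delta> / real n)) * c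
          = V n / (1 / c * w n * real n * ln (real n))" if "n \<ge> 1" for n
        using L_pos[OF that] by (simp add: field_simps)
      then show "eventually (\<lambda>n. V n / (L (real n) powr \<delta> * ln (real n)) / (w n / (L (real n) powr \<delta> / real n)) * c
          = V n / (1 / c * w n * real n * ln (real n))) sequentially"
        by (rule eventually_mono[OF ge1])
    qed
    then show "(\<lambda>n. (v_seq p m n)\<^sup>2) \<sim>[sequentially] (\<lambda>n. 1 / c * w n * real n * ln (real n))"
      by (intro asymp_equivI') (simp add: v V_nonneg)
  qed
  moreover have "Bseq (v_seq p m)" if "c < 0"
  proof -
    have "Bseq V"
      unfolding V_def using T.sum_bounded[OF that w_T] w_pos by (simp add: less_imp_le)
    then obtain K where "\<And>n. \<bar>V n\<bar> \<le> K"
      by (auto simp: Bseq_def)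
    then have "V n \<le> K" for n
      by (metis V_nonneg abs_of_nonneg)
    then have "norm (v_seq p m n) \<le> sqrt K" for n
      using V_nonneg[of n] by (simp add: v)
    then show ?thesis
      by (rule BseqI')
  qed
  moreover have "(\<lambda>n. (sigma_seq p m n)\<^sup>2) \<sim>[sequentially] (\<lambda>n. 1 / c * real n * ln (real n))" if "c > 0"
  proof -
    have "(\<lambda>n. (v_seq p m n)\<^sup>2 / w n) \<sim>[sequentially] (\<lambda>n. 1 / c * w n * real n * ln (real n) / w n)"
      by (intro asymp_equiv_intros v_asymp that)
    moreover have "(sigma_seq p m n)\<^sup>2 = (v_seq p m n)\<^sup>2 / w n" for n
      by (simp add: sigma_seq_def w_def power_divide power_mult_distrib)
    \<comment> \<open>The cancellation is claimed only from \<open>n = 1\<close> on: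
      \<open>m 0\<close> is unrestricted, so \<open>w 0\<close> may vanish.\<close>
    moreover have "eventually (\<lambda>n. 1 / c * w n * real n * ln (real n) / w n = 1 / c * real n * ln (real n)) sequentially"
      using ge1 by eventually_elim (use w_pos in force)
    ultimately show ?thesis
      by (elim asymp_equiv_transfer) simp
  qed
  moreover have "c > 0 \<longleftrightarrow> \<alpha> + \<gamma> + 1 > 0" "c < 0 \<longleftrightarrow> \<alpha> + \<gamma> + 1 < 0"
    using \<gamma>1 by (simp_all add: c_eq zero_less_divide_iff divide_less_0_iff)
  moreover have "1 / c = (\<gamma> + 1) / (\<alpha> + \<gamma> + 1)"
    by (simp add: c_eq)
  ultimately show ?thesis
    using \<open>C > 0\<close> unfolding w_def \<delta>_def by (auto simp: mult.assoc)
qed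

end
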